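(* For every $\alpha$ with $0<\alpha<0.2$, the limiting shape of first passage percolation with law $\nu_\alpha$ is the $\ell_1$ unit ball $\mathbf B=\{x\in\mathbb R^2:|x|_1\le1\}$.
   Context: Model. $\mathbb Z^2$ is the nearest-neighbour square lattice, with edge set $\mathcal E$; $\mathsf e_1,\mathsf e_2$ are the canonical basis vectors. Fix $0<\alpha<0.2$. Let $\mathbb N=\{0,1,2,\dots\}$ and $\Omega=\{0,1,2,3,4\}^{\mathbb N}$ with the uniform (product) probability measure. Let $\sigma:\Omega\to\Omega$ be the 5-adic adding machine: add one (mod 5) to the first coordinate; as long as the result is $0$, carry and add one (mod 5) to the next coordinate; all later coordinates are unchanged; $\sigma(444\dots)=000\dots$. The map $\sigma$ is a bijection. Put $L(\omega)=\min\{i:\omega(i)>0\}$ (defined off a null set). Let $\omega_1,\omega_2$ be independent and uniform on $\Omega$. For a vertex $v=(x,y)$ set $k(v,v+\mathsf e_1)=L(\sigma^{y}(\omega_1))$ and $k(v,v+\mathsf e_2)=L(\sigma^{x}(\omega_2))$. Let $\{X_{j,e}\}_{j\in\mathbb N,e\in\mathcal E}$ be independent, independent of $(\omega_1,\omega_2)$, with $X_{j,e}$ uniform on $[0,\alpha^j(1-\alpha)/1000]$. The passage time of the edge $e$ is $t_e=1+\alpha^{k(e)}+X_{k(e),e}$, and $\nu_\alpha$ is the law of $(t_e)_{e\in\mathcal E}$. The length of a finite path is $\Gamma(\pi)=\sum_{e\in\pi}t_e$, and $T(u,v)=\inf\Gamma(\pi)$ over paths $\pi$ from $u$ to $v$;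 $T$ is extended to $\mathbb R^2$ by applying the floor function to each coordinate. The limiting shape is the compact convex set $\mathbf B\subset\mathbb R^2$ such that for every $\epsilon>0$, almost surely $(1-\epsilon)\mathbf B\subset \frac1R\{x\in\mathbb R^2:T(\mathbf 0,x)<R\}\subset(1+\epsilon)\mathbf B$ for all large $R$; it is the unit ball of the norm $\|x\|=\lim_n T(\mathbf 0,nx)/n$ (limit a.s. and in $L_1$).
   Formalization: In the definition of the limiting shape, "every ε > 0" is read as 0 < ε < 1: for ε ≥ 2 the inclusion of (1−ε)B fails literally since T(0,x) is at least |x|₁ up to rounding; 1 ≤ ε < 2 and all larger outer inclusions follow from smaller ε. *)

theory Defs
  imports "HOL-Probability.Probability"
begin

section \<open>The adding machine\<close>

definition digit_seqs :: "(nat \<Rightarrow> nat) set" where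
  "digit_seqs = {w. \<forall>i. w i \<in> {0, 1, 2, 3, 4}}"

definition digit_measure :: "(nat \<Rightarrow> nat) measure" where
  "digit_measure = (\<Pi>\<^sub>M i\<in>UNIV. uniform_count_measure {0, 1, 2, 3, 4})"

text \<open>Adding one with carry changes the \<open>i\<close>-th digit exactly if all earlier digits are 4,
  since these are the digits that become 0.\<close>

definition add_one :: "(nat \<Rightarrow> nat) \<Rightarrow> (nat \<Rightarrow> nat)" where
  "add_one w = (\<lambda>i. if \<forall>j<i. w j = 4 then (w i + 1) mod 5 else w i)"

definition add_one_pow :: "int \<Rightarrow> (nat \<Rightarrow> nat) \<Rightarrow> (nat \<Rightarrow> nat)" where
  "add_one_pow n = (if 0 \<le> n then add_one ^^ nat n
                    else inv_into digit_seqs add_one ^^ nat (- n))"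

text \<open>The value at the zero sequence, which lies in a null set, is irrelevant.\<close>

definition first_nonzero :: "(nat \<Rightarrow> nat) \<Rightarrow> nat" where
  "first_nonzero w = (LEAST i. w i > 0)"


section \<open>The square lattice\<close>

type_synonym vertex = "int \<times> int"

datatype direction = Horizontal | Vertical

text \<open>The undirected edge \<open>{v, v + e\<^sub>1}\<close> is encoded as \<open>(v, Horizontal)\<close>,
  and \<open>{v, v + e\<^sub>2}\<close> as \<open>(v, Vertical)\<close>; every edge has exactly one code.\<close>

type_synonym edge = "vertex \<times> direction"

fun endpoints :: "edge \<Rightarrow> vertex set" where
  "endpoints ((x, y), Horizontal) = {(x, y), (x + 1, y)}"
| "endpoints ((x, y), Vertical) = {(x, y), (x, y + 1)}"

fun lattice_path :: "vertex \<Rightarrow> edge list \<Rightarrow> vertex \<Rightarrow> bool" where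
  "lattice_path u [] v \<longleftrightarrow> u = v"
| "lattice_path u (e # p) v \<longleftrightarrow> (\<exists>w. endpoints e = {u, w} \<and> lattice_path w p v)"


section \<open>The law of the passage times\<close>

fun edge_level :: "(nat \<Rightarrow> nat) \<Rightarrow> (nat \<Rightarrow> nat) \<Rightarrow> edge \<Rightarrow> nat" where
  "edge_level w1 w2 ((x, y), Horizontal) = first_nonzero (add_one_pow y w1)"
| "edge_level w1 w2 ((x, y), Vertical) = first_nonzero (add_one_pow x w2)"

definition perturbation_measure :: "real \<Rightarrow> (nat \<times> edge \<Rightarrow> real) measure" where
  "perturbation_measure \<alpha> =
     (\<Pi>\<^sub>M (j, e)\<in>UNIV. uniform_measure lborel {0 .. \<alpha> ^ j * (1 - \<alpha>) / 1000})"

definition environment_measure ::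
    "real \<Rightarrow> ((nat \<Rightarrow> nat) \<times> (nat \<Rightarrow> nat) \<times> (nat \<times> edge \<Rightarrow> real)) measure" where
  "environment_measure \<alpha> =
     digit_measure \<Otimes>\<^sub>M (digit_measure \<Otimes>\<^sub>M perturbation_measure \<alpha>)"

definition edge_time ::
    "real \<Rightarrow> (nat \<Rightarrow> nat) \<times> (nat \<Rightarrow> nat) \<times> (nat \<times> edge \<Rightarrow> real) \<Rightarrow> edge \<Rightarrow> real" where
  "edge_time \<alpha> = (\<lambda>(w1, w2, X) e.
     1 + \<alpha> ^ edge_level w1 w2 e + X (edge_level w1 w2 e, e))"

definition passage_law :: "real \<Rightarrow> (edge \<Rightarrow> real) measure" where
  "passage_law \<alpha> = distr (environment_measure \<alpha>) (\<Pi>\<^sub>M e\<in>UNIV. borel) (edge_time \<alpha>)"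


section \<open>First passage percolation\<close>

definition path_length :: "(edge \<Rightarrow> real) \<Rightarrow> edge list \<Rightarrow> real" where
  "path_length t p = (\<Sum>e\<leftarrow>p. t e)"

text \<open>Paths may repeat vertices; this does not affect the infimum, since the edge times are
  positive almost surely, which also bounds the set of path lengths below.\<close>

definition passage_time :: "(edge \<Rightarrow> real) \<Rightarrow> vertex \<Rightarrow> vertex \<Rightarrow> real" where
  "passage_time t u v = (INF p \<in> {p. lattice_path u p v}. path_length t p)"

definition floor_point :: "real \<times> real \<Rightarrow> vertex" where
  "floor_point x = (\<lfloor>fst x\<rfloor>, \<lfloor>snd x\<rfloor>)"

definition passage_time_plane :: "(edge \<Rightarrow> real) \<Rightarrow> real \<times> real \<Rightarrow> real \<times> real \<Rightarrow> real" where
  "passage_time_plane t x y = passage_time t (floor_point x) (floor_point y)"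

definition wet_region :: "(edge \<Rightarrow> real) \<Rightarrow> real \<Rightarrow> (real \<times> real) set" where
  "wet_region t R = {x. passage_time_plane t 0 x < R}"

text \<open>Only \<open>\<epsilon> < 1\<close> is meaningful: for \<open>\<epsilon> > 2\<close> the factor \<open>1 - \<epsilon>\<close> has absolute value
  greater than 1, and the inner inclusion fails for every symmetric shape with interior.\<close>

definition is_limiting_shape :: "(edge \<Rightarrow> real) measure \<Rightarrow> (real \<times> real) set \<Rightarrow> bool" where
  "is_limiting_shape \<nu> B \<longleftrightarrow> compact B \<and> convex B \<and>
     (\<forall>\<epsilon>. 0 < \<epsilon> \<and> \<epsilon> < 1 \<longrightarrow>
       (AE t in \<nu>. \<forall>\<^sub>F R in at_top.
          (\<lambda>x. (1 - \<epsilon>) *\<^sub>R x) ` B \<subseteq> (\<lambda>x. (1 / R) *\<^sub>R x) ` wet_region t R \<and>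
          (\<lambda>x. (1 / R) *\<^sub>R x) ` wet_region t R \<subseteq> (\<lambda>x. (1 + \<epsilon>) *\<^sub>R x) ` B))"


section \<open>Well-definedness\<close>

lemma space_digit_measure: "space digit_measure = digit_seqs"
  unfolding digit_measure_def digit_seqs_def space_PiM PiE_UNIV_domain
    space_uniform_count_measure Pi_def
  by simp

text \<open>\<open>sub_one\<close> is the inverse of the adding machine on digit sequences.\<close>

definition sub_one :: "(nat \<Rightarrow> nat) \<Rightarrow> (nat \<Rightarrow> nat)" where
  "sub_one w = (\<lambda>i. if \<forall>j<i. w j = 0 then (w i + 4) mod 5 else w i)"

lemma digit_cases:
  assumes "w \<in> digit_seqs"
  obtains "w i = 0" | "w i = 1" | "w i = 2" | "w i = 3" | "w i = 4"
proof -
  have "w i \<in> {0, 1, 2, 3, 4}" using assms unfolding digit_seqs_def by blast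
  then show thesis using that by blast
qed

lemma digit_seqs_iff: "w \<in> digit_seqs \<longleftrightarrow> (\<forall>i. w i < 5)"
proof -
  have "n \<in> {0, 1, 2, 3, 4} \<longleftrightarrow> n < 5" for n :: nat by auto
  then show ?thesis unfolding digit_seqs_def by simp
qed

lemma add_one_in_digit_seqs: "w \<in> digit_seqs \<Longrightarrow> add_one w \<in> digit_seqs"
  by (auto simp: digit_seqs_iff add_one_def)

lemma sub_one_in_digit_seqs: "w \<in> digit_seqs \<Longrightarrow> sub_one w \<in> digit_seqs"
  by (auto simp: digit_seqs_iff sub_one_def)

lemma add_one_zeros_iff:
  assumes "w \<in> digit_seqs"
  shows "(\<forall>j<i. add_one w j = 0) \<longleftrightarrow> (\<forall>j<i. w j = 4)"
proof (induction i)
  case (Suc i)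
  have "add_one w i = 0 \<longleftrightarrow> w i = 4" if "\<forall>j<i. w j = 4"
    using that by (cases rule: digit_cases[OF assms, of i]) (auto simp: add_one_def)
  with Suc show ?case by (auto simp: less_Suc_eq)
qed simp

lemma sub_one_fours_iff:
  assumes "w \<in> digit_seqs"
  shows "(\<forall>j<i. sub_one w j = 4) \<longleftrightarrow> (\<forall>j<i. w j = 0)"
proof (induction i)
  case (Suc i)
  have "sub_one w i = 4 \<longleftrightarrow> w i = 0" if "\<forall>j<i. w j = 0"
    using that by (cases rule: digit_cases[OF assms, of i]) (auto simp: sub_one_def)
  with Suc show ?case by (auto simp: less_Suc_eq)
qed simp

lemma sub_one_add_one:
  assumes "w \<in> digit_seqs"
  shows "sub_one (add_one w) = w"
proof
  fix i
  show "sub_one (add_one w) i = w i"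
    unfolding sub_one_def add_one_zeros_iff[OF assms]
    by (cases rule: digit_cases[OF assms, of i]) (auto simp: add_one_def)
qed

lemma add_one_sub_one:
  assumes "w \<in> digit_seqs"
  shows "add_one (sub_one w) = w"
proof
  fix i
  show "add_one (sub_one w) i = w i"
    unfolding add_one_def sub_one_fours_iff[OF assms]
    by (cases rule: digit_cases[OF assms, of i]) (auto simp: sub_one_def)
qed

lemma bij_betw_add_one: "bij_betw add_one digit_seqs digit_seqs"
  by (rule bij_betwI[where g = sub_one])
    (auto simp: add_one_in_digit_seqs sub_one_in_digit_seqs sub_one_add_one add_one_sub_one)

lemma inv_add_one: "w \<in> digit_seqs \<Longrightarrow> inv_into digit_seqs add_one w = sub_one w"
  by (rule inv_into_f_eq)
    (use bij_betw_add_one in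
      \<open>auto simp: bij_betw_def sub_one_in_digit_seqs add_one_sub_one\<close>)

lemma measurable_digit: "(\<lambda>w. w i) \<in> measurable digit_measure (count_space UNIV)"
proof -
  have "(\<lambda>w. w i) \<in> measurable digit_measure (uniform_count_measure {0, 1, 2, 3, 4})"
    unfolding digit_measure_def by (rule measurable_component_singleton) simp
  also have "\<dots> = measurable digit_measure (count_space {0, 1, 2, 3, 4})"
    by (rule measurable_cong_sets)
      (auto simp: sets_uniform_count_measure)
  finally have *: "(\<lambda>w. w i) \<in> measurable digit_measure (count_space {0, 1, 2, 3, 4})" .
  show ?thesis
    by (rule measurable_compose[OF *]) simp
qed

lemma pred_digits: "Measurable.pred digit_measure (\<lambda>w. \<forall>j<i. w j = c)"
proof -
  have "Measurable.pred digit_measure (\<lambda>w. w j = c)" for j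
    by (rule measurable_compose[OF measurable_digit]) simp
  then show ?thesis
    by (intro pred_intros_countable pred_intros_logic) simp_all
qed

lemma measurable_carry:
  "(\<lambda>w. if \<forall>j<i. w j = c then (w i + d) mod 5 else w i) \<in> measurable digit_measure (count_space UNIV)"
proof (rule measurable_If)
  show "(\<lambda>w. (w i + d) mod 5) \<in> measurable digit_measure (count_space UNIV)"
    by (rule measurable_compose[OF measurable_digit]) simp
qed (rule measurable_digit, rule pred_digits[unfolded pred_def])

lemma measurable_into_digit_measure:
  assumes "\<And>w. w \<in> space M \<Longrightarrow> f w \<in> digit_seqs"
    and "\<And>i. (\<lambda>w. f w i) \<in> measurable M (count_space UNIV)"
  shows "f \<in> measurable M digit_measure"
  unfolding digit_measure_def
proof (rule measurable_PiM_single')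
  fix i :: nat
  have "(\<lambda>w. f w i) \<in> measurable M (count_space {0, 1, 2, 3, 4})"
  proof (subst measurable_count_space_eq2, simp, intro conjI ballI)
    show "(\<lambda>w. f w i) \<in> space M \<rightarrow> {0, 1, 2, 3, 4}"
      using assms(1) unfolding digit_seqs_def by blast
    show "(\<lambda>w. f w i) -` {a} \<inter> space M \<in> sets M" for a
      by (rule measurable_sets[OF assms(2)]) simp
  qed
  also have "\<dots> = measurable M (uniform_count_measure {0, 1, 2, 3, 4})"
    by (rule measurable_cong_sets)
      (auto simp: sets_uniform_count_measure)
  finally show "(\<lambda>w. f w i) \<in> measurable M (uniform_count_measure {0, 1, 2, 3, 4})" .
next
  show "f \<in> space M \<rightarrow> (\<Pi>\<^sub>E i\<in>UNIV. space (uniform_count_measure {0, 1, 2, 3, 4}))"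
    using assms(1) by (auto simp: digit_seqs_def PiE_UNIV_domain space_uniform_count_measure)
qed

lemma measurable_add_one: "add_one \<in> measurable digit_measure digit_measure"
  by (rule measurable_into_digit_measure)
    (simp add: space_digit_measure add_one_in_digit_seqs, simp only: add_one_def measurable_carry)

lemma measurable_inv_add_one:
  "inv_into digit_seqs add_one \<in> measurable digit_measure digit_measure"
proof -
  have "sub_one \<in> measurable digit_measure digit_measure"
    by (rule measurable_into_digit_measure)
      (simp add: space_digit_measure sub_one_in_digit_seqs, simp only: sub_one_def measurable_carry)
  then show ?thesis
    by (subst measurable_cong[where g = sub_one])
      (simp_all add: space_digit_measure inv_add_one)
qed

lemma measurable_add_one_pow [measurable]:
  "add_one_pow n \<in> measurable digit_measure digit_measure"
  unfolding add_one_pow_def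
  by (auto intro!: measurable_compose_n measurable_add_one measurable_inv_add_one)

lemma measurable_first_nonzero [measurable]:
  "first_nonzero \<in> measurable digit_measure (count_space UNIV)"
  unfolding first_nonzero_def
  by (intro measurable_Least measurable_compose[OF measurable_digit]) simp

lemma prob_space_digit_measure: "prob_space digit_measure"
  unfolding digit_measure_def by (intro prob_space_PiM prob_space_uniform_count_measure) auto

lemma prob_space_perturbation_measure:
  assumes "0 < \<alpha>" "\<alpha> < 1"
  shows "prob_space (perturbation_measure \<alpha>)"
  unfolding perturbation_measure_def
proof (rule prob_space_PiM)
  fix i :: "nat \<times> edge"
  obtain j e where i: "i = (j, e)" by (cases i)
  have "0 < \<alpha> ^ j * (1 - \<alpha>) / 1000" using assms by simp
  then show "prob_space (case i of (j, e) \<Rightarrow> uniform_measure lborel {0 .. \<alpha> ^ j * (1 - \<alpha>) / 1000})"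
    unfolding i by (simp only: prod.case, intro prob_space_uniform_measure)
      (simp_all add: ennreal_eq_0_iff del: divide_eq_0_iff mult_eq_0_iff)
qed

lemma measurable_perturbation [measurable]:
  "(\<lambda>X. X i) \<in> borel_measurable (perturbation_measure \<alpha>)"
proof -
  have "(\<lambda>X. X i) \<in> measurable (perturbation_measure \<alpha>)
      (case i of (j, e) \<Rightarrow> uniform_measure lborel {0 .. \<alpha> ^ j * (1 - \<alpha>) / 1000})"
    unfolding perturbation_measure_def by (rule measurable_component_singleton) simp
  also have "\<dots> = borel_measurable (perturbation_measure \<alpha>)"
    by (rule measurable_cong_sets) (auto split: prod.split)
  finally show ?thesis .
qed

lemma measurable_edge_level [measurable]:
  "(\<lambda>(w1, w2, X). edge_level w1 w2 e) \<in> measurable (environment_measure \<alpha>) (count_space UNIV)"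
  unfolding environment_measure_def
  by (cases e rule: edge_level.cases[of "(undefined, undefined, e)" for e, simplified]) simp_all

lemma measurable_edge_time: "edge_time \<alpha> \<in> measurable (environment_measure \<alpha>) (\<Pi>\<^sub>M e\<in>UNIV. borel)"
proof (rule measurable_PiM_single')
  fix e
  have [measurable]: "(\<lambda>\<omega>. snd (snd \<omega>) i) \<in> borel_measurable (environment_measure \<alpha>)" for i
    unfolding environment_measure_def by measurable
  have "(\<lambda>\<omega>. (\<lambda>j \<omega>. 1 + \<alpha> ^ j + snd (snd \<omega>) (j, e)) ((\<lambda>(w1, w2, X). edge_level w1 w2 e) \<omega>) \<omega>)
      \<in> borel_measurable (environment_measure \<alpha>)"
    by (rule measurable_compose_countable[OF _ measurable_edge_level]) measurable
  then show "(\<lambda>\<omega>. edge_time \<alpha> \<omega> e) \<in> borel_measurable (environment_measure \<alpha>)"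
    by (simp add: edge_time_def case_prod_unfold)
qed auto

lemma prob_space_passage_law:
  assumes "0 < \<alpha>" "\<alpha> < 1"
  shows "prob_space (passage_law \<alpha>)"
proof -
  interpret D: prob_space digit_measure by (rule prob_space_digit_measure)
  interpret P: prob_space "perturbation_measure \<alpha>"
    using assms by (rule prob_space_perturbation_measure)
  interpret DP: pair_prob_space digit_measure "perturbation_measure \<alpha>" ..
  interpret E: pair_prob_space digit_measure "digit_measure \<Otimes>\<^sub>M perturbation_measure \<alpha>" ..
  show ?thesis
    unfolding passage_law_def
    by (rule prob_space.prob_space_distr[OF _ measurable_edge_time])
      (simp add: environment_measure_def E.prob_space_axioms)
qed

end

theory Submission
  imports Defs
begin

text \<open>The lower bound \<open>t\<^sub>e \<ge> 1\<close> gives the outer inclusion. For the inner one, the adding machine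
  adds 1 to the 5-adic number encoded by a digit sequence, so every window of \<open>5\<^sup>k\<^sup>+\<^sup>1\<close>
  consecutive rows (or columns) contains one of level exactly \<open>k\<close>, all of whose edges take
  time at most \<open>1 + 2 \<alpha>\<^sup>k\<close>. Following such a row near the origin and then such a column
  near the target costs at most \<open>1 + 2 \<alpha>\<^sup>k\<close> per step, up to a detour of bounded length.\<close>

section \<open>Periodicity of the levels\<close>

text \<open>The representative in \<open>[0, 5 ^ n)\<close> of the 5-adic integer with digits
  \<open>w\<close> modulo \<open>5 ^ n\<close>, least significant digit first. It is an
  \<open>int\<close> so that negative translations can be treated as well.\<close>

definition prefix_value :: "nat \<Rightarrow> (nat \<Rightarrow> nat) \<Rightarrow> int" where
  "prefix_value n w = (\<Sum>i<n. int (w i) * 5 ^ i)"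

lemma prefix_value_Suc: "prefix_value (Suc n) w = prefix_value n w + int (w n) * 5 ^ n"
  by (simp add: prefix_value_def)

lemma prefix_value_nonneg: "0 \<le> prefix_value n w"
  by (simp add: prefix_value_def sum_nonneg)

lemma prefix_value_less:
  assumes "w \<in> digit_seqs"
  shows "prefix_value n w < 5 ^ n"
proof (induction n)
  case 0
  show ?case by (simp add: prefix_value_def)
next
  case (Suc n)
  have "int (w n) \<le> 4"
    by (cases rule: digit_cases[OF assms, of n]) auto
  then have "int (w n) * 5 ^ n \<le> 4 * 5 ^ n" by (intro mult_right_mono) auto
  then show ?case using Suc unfolding prefix_value_Suc power_Suc by linarith
qed

text \<open>The carry leaves the first \<open>n\<close> digits exactly when all of them are 4. They
  then reset to 0, which loses \<open>5 ^ n\<close>.\<close>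

lemma prefix_value_add_one:
  assumes "w \<in> digit_seqs"
  shows "prefix_value n (add_one w) =
    prefix_value n w + 1 - (if \<forall>j<n. w j = 4 then 5 ^ n else 0)"
proof (induction n)
  case 0
  show ?case by (simp add: prefix_value_def)
next
  case (Suc n)
  show ?case
  proof (cases "\<forall>j<n. w j = 4")
    case True
    \<comment> \<open>The carry reaches digit \<open>n\<close>: a 4 becomes 0 and passes it on, any
      other digit absorbs it.\<close>
    then have "add_one w n = (w n + 1) mod 5" by (simp add: add_one_def)
    with True Suc show ?thesis
      by (cases rule: digit_cases[OF assms, of n])
        (simp_all add: prefix_value_Suc less_Suc_eq)
  next
    case False
    then have "add_one w n = w n" by (auto simp: add_one_def)
    moreover have "\<not> (\<forall>j<Suc n. w j = 4)" using False less_SucI by blast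
    ultimately show ?thesis using False Suc by (simp only: prefix_value_Suc if_False)
  qed
qed

lemma prefix_value_add_one_mod:
  assumes "w \<in> digit_seqs"
  shows "prefix_value n (add_one w) mod 5 ^ n = (prefix_value n w + 1) mod 5 ^ n"
  unfolding prefix_value_add_one[OF assms] by simp

text \<open>Apply the congruence for \<open>add_one\<close> to \<open>sub_one w\<close> and subtract
  1.\<close>

lemma prefix_value_sub_one_mod:
  assumes "w \<in> digit_seqs"
  shows "prefix_value n (sub_one w) mod 5 ^ n = (prefix_value n w - 1) mod 5 ^ n"
proof -
  have "(prefix_value n w - 1) mod 5 ^ n = (prefix_value n (sub_one w) + 1 - 1) mod 5 ^ n"
    using prefix_value_add_one_mod[OF sub_one_in_digit_seqs[OF assms], of n]
    unfolding add_one_sub_one[OF assms] by (rule mod_diff_cong) simp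
  then show ?thesis by simp
qed

lemma add_one_pow_in_digit_seqs:
  assumes "w \<in> digit_seqs"
  shows "add_one_pow y w \<in> digit_seqs"
proof -
  have "(add_one ^^ n) w \<in> digit_seqs" for n
    by (induction n) (simp_all add: assms add_one_in_digit_seqs)
  moreover have "(inv_into digit_seqs add_one ^^ n) w \<in> digit_seqs" for n
    by (induction n) (simp_all add: assms inv_add_one sub_one_in_digit_seqs)
  ultimately show ?thesis by (simp add: add_one_pow_def)
qed

text \<open>Modulo \<open>5 ^ n\<close> the adding machine is translation by 1 on a cyclic group, so
  its \<open>y\<close>-th power is translation by \<open>y\<close>. The two signs of
  \<open>y\<close> need separate inductions.\<close>

lemma prefix_value_add_one_pow_mod:
  assumes "w \<in> digit_seqs"
  shows "prefix_value n (add_one_pow y w) mod 5 ^ n = (prefix_value n w + y) mod 5 ^ n"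
proof -
  \<comment> \<open>Membership in \<open>digit_seqs\<close> is carried through the induction because
    the one-step congruence requires it.\<close>
  have up: "(add_one ^^ m) w \<in> digit_seqs \<and>
      prefix_value n ((add_one ^^ m) w) mod 5 ^ n = (prefix_value n w + int m) mod 5 ^ n" for m
  proof (induction m)
    case (Suc m)
    then show ?case
      by (simp add: add_one_in_digit_seqs prefix_value_add_one_mod)
        (metis add.assoc add.commute mod_add_left_eq)
  qed (simp add: assms)
  have down: "(inv_into digit_seqs add_one ^^ m) w \<in> digit_seqs \<and>
      prefix_value n ((inv_into digit_seqs add_one ^^ m) w) mod 5 ^ n
        = (prefix_value n w - int m) mod 5 ^ n" for m
  proof (induction m)
    case (Suc m)
    then show ?case
      by (simp add: inv_add_one sub_one_in_digit_seqs prefix_value_sub_one_mod)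
        (metis diff_diff_eq add.commute mod_diff_left_eq)
  qed (simp add: assms)
  show ?thesis
    using up[of "nat y"] down[of "nat (- y)"] by (simp add: add_one_pow_def)
qed

text \<open>Base 5 expansions are unique, and that of \<open>5 ^ k\<close> has digit 1 at position
  \<open>k\<close> and 0 below it.\<close>

lemma first_nonzero_of_prefix_value:
  assumes "w \<in> digit_seqs" and "prefix_value (Suc k) w = 5 ^ k"
  shows "first_nonzero w = k"
proof -
  have eq: "prefix_value k w + int (w k) * 5 ^ k = 5 ^ k"
    using assms(2) by (simp add: prefix_value_Suc)
  \<comment> \<open>The lower digits contribute a number in \<open>[0, 5 ^ k)\<close>, so the
    division isolates digit \<open>k\<close>.\<close>
  have "(prefix_value k w + int (w k) * 5 ^ k) div 5 ^ k = int (w k)"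
    using prefix_value_nonneg[of k w] prefix_value_less[OF assms(1), of k] by simp
  then have one: "w k = 1" unfolding eq by simp
  then have "prefix_value k w = 0" using eq by simp
  then have "\<forall>i<k. w i = 0"
    by (simp add: prefix_value_def sum_nonneg_eq_0_iff)
  then show ?thesis
    unfolding first_nonzero_def using one
    by (intro Least_equality) (auto simp: not_less[symmetric])
qed

text \<open>As \<open>y\<close> runs through \<open>5 ^ Suc k\<close> consecutive integers, the
  first \<open>Suc k\<close> digits take every residue once, in particular
  \<open>5 ^ k\<close>.\<close>

lemma level_in_window:
  assumes "w \<in> digit_seqs"
  shows "\<exists>y. y0 \<le> y \<and> y < y0 + 5 ^ Suc k \<and> first_nonzero (add_one_pow y w) = k"
proof -
  define N :: int where "N = 5 ^ Suc k"
  \<comment> \<open>The unique point of the window at which the translated residue is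
    \<open>5 ^ k\<close> modulo \<open>N\<close>.\<close>
  define y where "y = y0 + (5 ^ k - prefix_value (Suc k) w - y0) mod N"
  have "N > 0" by (simp add: N_def)
  have "(prefix_value (Suc k) w + y) mod N = 5 ^ k mod N"
    unfolding y_def by (simp add: mod_simps add.assoc[symmetric])
  then have "prefix_value (Suc k) (add_one_pow y w) mod N = 5 ^ k mod N"
    using prefix_value_add_one_pow_mod[OF assms, of "Suc k" y] by (simp only: N_def)
  \<comment> \<open>Both sides of the congruence are already reduced modulo \<open>N\<close>, so it
    is an equality.\<close>
  moreover have "prefix_value (Suc k) (add_one_pow y w) mod N = prefix_value (Suc k) (add_one_pow y w)"
    using prefix_value_nonneg prefix_value_less[OF add_one_pow_in_digit_seqs[OF assms]]
    unfolding N_def by (rule mod_pos_pos_trivial)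
  moreover have "(5::int) ^ k mod N = 5 ^ k" unfolding N_def by (rule mod_pos_pos_trivial) auto
  ultimately have "first_nonzero (add_one_pow y w) = k"
    by (intro first_nonzero_of_prefix_value add_one_pow_in_digit_seqs assms) simp
  moreover have "y0 \<le> y" "y < y0 + N"
    unfolding y_def using \<open>N > 0\<close> by (auto simp: pos_mod_bound)
  ultimately show ?thesis unfolding N_def by blast
qed

section \<open>Almost sure properties of the passage times\<close>

text \<open>Collects everything that the geometric argument needs to know about the environment. It
  speaks of the edge times alone, so it makes sense under \<open>passage_law\<close>.\<close>

definition regular_times :: "real \<Rightarrow> (edge \<Rightarrow> real) \<Rightarrow> bool" where
  "regular_times \<alpha> t \<longleftrightarrow>
     (\<forall>e. 1 \<le> t e \<and> t e \<le> 3) \<and>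
     (\<forall>k y0. \<exists>y. y0 \<le> y \<and> y < y0 + 5 ^ Suc k \<and> (\<forall>x. t ((x, y), Horizontal) \<le> 1 + 2 * \<alpha> ^ k)) \<and>
     (\<forall>k x0. \<exists>x. x0 \<le> x \<and> x < x0 + 5 ^ Suc k \<and> (\<forall>y. t ((x, y), Vertical) \<le> 1 + 2 * \<alpha> ^ k))"

lemma regular_edge_time:
  assumes "0 < \<alpha>" "\<alpha> < 1"
    and w1: "w1 \<in> digit_seqs" and w2: "w2 \<in> digit_seqs"
    and X: "\<And>j e. X (j, e) \<in> {0 .. \<alpha> ^ j * (1 - \<alpha>) / 1000}"
  shows "regular_times \<alpha> (edge_time \<alpha> (w1, w2, X))"
proof -
  \<comment> \<open>Bounding \<open>(1 - \<alpha>) / 1000\<close> by 1 is crude but gives an excess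
    over 1 of at most \<open>2 * \<alpha> ^ j\<close>, which still vanishes as the level
    \<open>j\<close> grows.\<close>
  have X_le: "X (j, e) \<le> \<alpha> ^ j" for j e
  proof -
    have "\<alpha> ^ j * (1 - \<alpha>) / 1000 \<le> \<alpha> ^ j * 1"
      unfolding times_divide_eq_right[symmetric] using assms(1,2) by (intro mult_left_mono) auto
    with X[of j e] show ?thesis by auto
  qed
  have t_le: "edge_time \<alpha> (w1, w2, X) e \<le> 1 + 2 * \<alpha> ^ edge_level w1 w2 e" for e
    using X_le[of "edge_level w1 w2 e" e] by (simp add: edge_time_def)
  have "\<alpha> ^ j \<le> 1" for j using assms by (simp add: power_le_one)
  then have "edge_time \<alpha> (w1, w2, X) e \<le> 3" for e
    using t_le[of e] by (smt (verit))
  moreover have "1 \<le> edge_time \<alpha> (w1, w2, X) e" for e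
    using X[of "edge_level w1 w2 e" e] assms by (simp add: edge_time_def)
  moreover have "\<exists>y. y0 \<le> y \<and> y < y0 + 5 ^ Suc k \<and>
      (\<forall>x. edge_time \<alpha> (w1, w2, X) ((x, y), Horizontal) \<le> 1 + 2 * \<alpha> ^ k)" for k y0
    using level_in_window[OF w1, of y0 k] t_le by (metis edge_level.simps(1))
  moreover have "\<exists>x. x0 \<le> x \<and> x < x0 + 5 ^ Suc k \<and>
      (\<forall>y. edge_time \<alpha> (w1, w2, X) ((x, y), Vertical) \<le> 1 + 2 * \<alpha> ^ k)" for k x0
    using level_in_window[OF w2, of x0 k] t_le by (metis edge_level.simps(2))
  ultimately show ?thesis unfolding regular_times_def by blast
qed

text \<open>Makes \<open>edge\<close> countable, so that almost sure and measurable statements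
  survive quantification over all edges.\<close>

instance direction :: countable
  by countable_datatype

lemma AE_perturbation_bounds:
  assumes "0 < \<alpha>" "\<alpha> < 1"
  shows "AE X in perturbation_measure \<alpha>. \<forall>i. X i \<in> {0 .. \<alpha> ^ fst i * (1 - \<alpha>) / 1000}"
  unfolding AE_all_countable
proof
  fix i :: "nat \<times> edge"
  have pos: "0 < \<alpha> ^ j * (1 - \<alpha>) / 1000" for j using assms by simp
  show "AE X in perturbation_measure \<alpha>. X i \<in> {0 .. \<alpha> ^ fst i * (1 - \<alpha>) / 1000}"
    unfolding perturbation_measure_def
  proof (rule AE_PiM_component)
    show "prob_space (case i of (j, e) \<Rightarrow> uniform_measure lborel {0 .. \<alpha> ^ j * (1 - \<alpha>) / 1000})"
      for i :: "nat \<times> edge"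
      unfolding case_prod_unfold using pos[of "fst i"]
      by (intro prob_space_uniform_measure)
        (simp_all add: ennreal_eq_0_iff del: divide_eq_0_iff mult_eq_0_iff)
    show "AE x in (case i of (j, e) \<Rightarrow> uniform_measure lborel {0 .. \<alpha> ^ j * (1 - \<alpha>) / 1000}).
        x \<in> {0 .. \<alpha> ^ fst i * (1 - \<alpha>) / 1000}"
      unfolding case_prod_unfold by (rule AE_uniform_measureI) auto
  qed simp
qed

text \<open>A null set \<open>N\<close> of the second factor yields the null set
  \<open>space M1 \<times> N\<close> of the product.\<close>

lemma AE_pair_snd:
  assumes "sigma_finite_measure M2" and "AE x in M2. P x"
  shows "AE z in M1 \<Otimes>\<^sub>M M2. P (snd z)"
proof -
  interpret M2: sigma_finite_measure M2 by fact
  obtain N where N: "\<And>x. x \<in> space M2 - N \<Longrightarrow> P x" "N \<in> null_sets M2"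
    using AE_E3[OF assms(2)] by blast
  have "emeasure (M1 \<Otimes>\<^sub>M M2) (space M1 \<times> N) = 0"
    using M2.emeasure_pair_measure_Times[OF sets.top null_setsD2[OF N(2)]] null_setsD1[OF N(2)]
    by simp
  then have "space M1 \<times> N \<in> null_sets (M1 \<Otimes>\<^sub>M M2)"
    using N(2) by (intro null_setsI) auto
  then show ?thesis
    by (rule AE_I') (use N(1) in \<open>force simp: space_pair_measure\<close>)
qed

text \<open>Every point of the space of \<open>digit_measure\<close> is a digit sequence, so only
  the perturbation bounds contribute an exceptional null set.\<close>

lemma AE_environment_regular:
  assumes "0 < \<alpha>" "\<alpha> < 1"
  shows "AE \<omega> in environment_measure \<alpha>. regular_times \<alpha> (edge_time \<alpha> \<omega>)"
proof -
  let ?P = "perturbation_measure \<alpha>"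
  interpret P: prob_space ?P
    using assms by (rule prob_space_perturbation_measure)
  interpret D: prob_space digit_measure by (rule prob_space_digit_measure)
  interpret DP: pair_prob_space digit_measure ?P ..
  have "AE \<omega> in environment_measure \<alpha>.
      \<forall>i. snd (snd \<omega>) i \<in> {0 .. \<alpha> ^ fst i * (1 - \<alpha>) / 1000}"
    unfolding environment_measure_def
    \<comment> \<open>\<open>AE_pair_snd\<close> is used twice, once for each digit factor.\<close>
    by (intro AE_pair_snd AE_perturbation_bounds assms) unfold_locales
  then show ?thesis
    using AE_space
  proof eventually_elim
    case (elim \<omega>)
    then show ?case
      using regular_edge_time[OF assms, of "fst \<omega>" "fst (snd \<omega>)" "snd (snd \<omega>)"]
      by (force simp: environment_measure_def space_pair_measure space_digit_measure)
  qed
qed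

text \<open>Only countable quantifiers over bounds on single coordinates occur. Measurability is
  what allows the passage from the environment to its image law.\<close>

lemma measurable_regular_times:
  "Measurable.pred (\<Pi>\<^sub>M e\<in>UNIV. borel) (regular_times \<alpha>)"
proof -
  let ?M = "\<Pi>\<^sub>M e\<in>(UNIV :: edge set). (borel :: real measure)"
  have comp: "(\<lambda>t. t e) \<in> borel_measurable ?M" for e
    by simp
  have "Measurable.pred ?M (\<lambda>t. c \<le> t e)" "Measurable.pred ?M (\<lambda>t. t e \<le> c)" for c e
    using borel_measurable_le[OF borel_measurable_const comp]
      borel_measurable_le[OF comp borel_measurable_const] by (simp_all add: pred_def)
  then show ?thesis
    unfolding regular_times_def[abs_def]
    by (intro pred_intros_logic pred_intros_countable) simp_all
qed

lemma AE_regular: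
  assumes "0 < \<alpha>" "\<alpha> < 1"
  shows "AE t in passage_law \<alpha>. regular_times \<alpha> t"
  unfolding passage_law_def
  using AE_environment_regular[OF assms] measurable_regular_times
  by (subst AE_distr_iff[OF measurable_edge_time]) (simp_all add: pred_def)

section \<open>Bounds on the passage time\<close>

lemma lattice_path_append:
  "lattice_path u p v \<Longrightarrow> lattice_path v q w \<Longrightarrow> lattice_path u (p @ q) w"
  by (induction p arbitrary: u) auto

text \<open>\<open>endpoints\<close> is an unordered pair, so each edge can be crossed in either
  direction.\<close>

lemma lattice_path_rev:
  "lattice_path u p v \<Longrightarrow> lattice_path v (rev p) u"
proof (induction p arbitrary: u)
  case (Cons e p)
  then obtain w where w: "endpoints e = {u, w}" "lattice_path w p v" by auto
  from w(1) have "lattice_path w [e] u"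
    unfolding lattice_path.simps by (intro exI[of _ u]) (simp add: insert_commute)
  with Cons.IH[OF w(2)] show ?case by (auto intro: lattice_path_append)
qed simp

lemma path_length_append: "path_length t (p @ q) = path_length t p + path_length t q"
  by (simp add: path_length_def)

lemma path_length_rev: "path_length t (rev p) = path_length t p"
  by (simp add: path_length_def rev_map[symmetric])

lemma horizontal_path:
  assumes "\<And>x. t ((x, y), Horizontal) \<le> c"
  shows "\<exists>p. lattice_path (a, y) p (b, y) \<and> path_length t p \<le> c * \<bar>b - a\<bar>"
proof -
  have right: "\<exists>p. lattice_path (a, y) p (a + int n, y) \<and> path_length t p \<le> c * n" for a n
  proof (induction n)
    case 0
    show ?case by (intro exI[of _ "[]"]) (simp add: path_length_def)
  next
    case (Suc n)
    then obtain p where p: "lattice_path (a, y) p (a + int n, y)" "path_length t p \<le> c * n" by blast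
    have "lattice_path (a + int n, y) [((a + int n, y), Horizontal)] (a + int (Suc n), y)"
      by (simp add: ac_simps)
    note path = lattice_path_append[OF p(1) this]
    have "path_length t (p @ [((a + int n, y), Horizontal)]) = path_length t p + t ((a + int n, y), Horizontal)"
      by (simp add: path_length_def)
    also have "\<dots> \<le> c * Suc n"
      using p(2) assms[of "a + int n"] by (simp add: distrib_left)
    finally show ?case using path by blast
  qed
  show ?thesis
  proof (cases "a \<le> b")
    case True
    then show ?thesis using right[of a "nat (b - a)"] by simp
  next
    case False
    then show ?thesis
      \<comment> \<open>A leftward path is the reversal of a rightward one, with the same
        length.\<close>
      using right[of b "nat (a - b)"]
      by simp (metis lattice_path_rev path_length_rev)
  qed
qed

lemma vertical_path:
  assumes "\<And>y. t ((x, y), Vertical) \<le> c"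
  shows "\<exists>p. lattice_path (x, a) p (x, b) \<and> path_length t p \<le> c * \<bar>b - a\<bar>"
proof -
  have up: "\<exists>p. lattice_path (x, a) p (x, a + int n) \<and> path_length t p \<le> c * n" for a n
  proof (induction n)
    case 0
    show ?case by (intro exI[of _ "[]"]) (simp add: path_length_def)
  next
    case (Suc n)
    then obtain p where p: "lattice_path (x, a) p (x, a + int n)" "path_length t p \<le> c * n" by blast
    have "lattice_path (x, a + int n) [((x, a + int n), Vertical)] (x, a + int (Suc n))"
      by (simp add: ac_simps)
    note path = lattice_path_append[OF p(1) this]
    have "path_length t (p @ [((x, a + int n), Vertical)]) = path_length t p + t ((x, a + int n), Vertical)"
      by (simp add: path_length_def)
    also have "\<dots> \<le> c * Suc n"
      using p(2) assms[of "a + int n"] by (simp add: distrib_left)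
    finally show ?case using path by blast
  qed
  show ?thesis
  proof (cases "a \<le> b")
    case True
    then show ?thesis using up[of a "nat (b - a)"] by simp
  next
    case False
    then show ?thesis
      using up[of b "nat (a - b)"]
      by simp (metis lattice_path_rev path_length_rev)
  qed
qed

text \<open>Each edge moves the position by at most 1 in the l1 distance and costs at least
  1.\<close>

lemma l1_dist_le_path_length:
  assumes "\<And>e. 1 \<le> t e"
  shows "lattice_path u p v \<Longrightarrow> real_of_int (\<bar>fst v - fst u\<bar> + \<bar>snd v - snd u\<bar>) \<le> path_length t p"
proof (induction p arbitrary: u)
  case (Cons e p)
  then obtain w where w: "endpoints e = {u, w}" "lattice_path w p v" by auto
  obtain x y d where e: "e = ((x, y), d)" by (metis surj_pair)
  have "\<bar>fst w - fst u\<bar> + \<bar>snd w - snd u\<bar> \<le> 1"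
    using w(1) unfolding e by (cases d) (auto simp: doubleton_eq_iff)
  with Cons.IH[OF w(2)] assms[of e] show ?case by (simp add: path_length_def)
qed (simp add: path_length_def)

lemma passage_time_le:
  assumes "\<And>e. 1 \<le> t e" and "lattice_path u p v"
  shows "passage_time t u v \<le> path_length t p"
proof -
  \<comment> \<open>The real infimum is a lower bound of the path lengths only if these are bounded
    below.\<close>
  have "0 \<le> path_length t q" for q
    unfolding path_length_def by (intro sum_list_nonneg) (use assms(1) in \<open>force intro: order_trans[of 0 1]\<close>)
  then have "bdd_below (path_length t ` {p. lattice_path u p v})" by (intro bdd_belowI[of _ 0]) auto
  then show ?thesis
    unfolding passage_time_def using assms(2) by (intro cINF_lower) auto
qed

lemma passage_time_ge:
  assumes "\<And>e. 1 \<le> t e"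
  shows "real_of_int (\<bar>fst v - fst u\<bar> + \<bar>snd v - snd u\<bar>) \<le> passage_time t u v"
proof -
  obtain a b where u: "u = (a, b)" by (cases u)
  obtain c d where v: "v = (c, d)" by (cases v)
  \<comment> \<open>Edge times identically 0 are plugged in because only the existence of a path
    matters here.\<close>
  have "\<exists>p. lattice_path (a, b) p (c, b)"
    using horizontal_path[of "\<lambda>_. 0" b 0] by force
  moreover have "\<exists>p. lattice_path (c, b) p (c, d)"
    using vertical_path[of "\<lambda>_. 0" c 0] by force
  ultimately have "{p. lattice_path u p v} \<noteq> {}"
    using lattice_path_append unfolding u v by blast
  then show ?thesis
    unfolding passage_time_def
    by (intro cINF_greatest) (use l1_dist_le_path_length[of t u _ v] assms in auto)
qed

text \<open>Climb from the origin to a cheap row \<open>y\<close>, follow it to a cheap column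
  \<open>x\<close> close to \<open>a\<close>, follow that to height \<open>b\<close>, and return to
  \<open>(a, b)\<close>. The long pieces cost \<open>c\<close> per edge, the short ones at most
  3.\<close>

lemma passage_time_le_regular:
  assumes reg: "regular_times \<alpha> t" and \<alpha>: "0 < \<alpha>" "\<alpha> < 1"
  shows "passage_time t (0, 0) (a, b) \<le> (1 + 2 * \<alpha> ^ k) * (\<bar>a\<bar> + \<bar>b\<bar>) + 12 * 5 ^ Suc k"
proof -
  define N :: int where "N = 5 ^ Suc k"
  define c where "c = 1 + 2 * \<alpha> ^ k"
  have c: "0 \<le> c" "c \<le> 3" using \<alpha> by (simp_all add: c_def power_le_one)
  have ge: "1 \<le> t e" and le: "t e \<le> 3" for e using reg unfolding regular_times_def by blast+
  obtain y where y: "0 \<le> y" "y < N" "\<And>x. t ((x, y), Horizontal) \<le> c"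
    using reg unfolding regular_times_def N_def c_def by (metis add_0)
  \<comment> \<open>The window starts at \<open>a\<close>, so the return along row \<open>b\<close>
    has fewer than \<open>N\<close> edges.\<close>
  obtain x where x: "a \<le> x" "x < a + N" "\<And>y. t ((x, y), Vertical) \<le> c"
    using reg unfolding regular_times_def N_def c_def by metis
  obtain p1 where p1: "lattice_path (0, 0) p1 (0, y)" "path_length t p1 \<le> 3 * \<bar>y - 0\<bar>"
    using vertical_path[of t 0 3 0 y] le by auto
  obtain p2 where p2: "lattice_path (0, y) p2 (x, y)" "path_length t p2 \<le> c * \<bar>x - 0\<bar>"
    using horizontal_path[of t y c 0 x] y(3) by auto
  obtain p3 where p3: "lattice_path (x, y) p3 (x, b)" "path_length t p3 \<le> c * \<bar>b - y\<bar>"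
    using vertical_path[of t x c y b] x(3) by auto
  obtain p4 where p4: "lattice_path (x, b) p4 (a, b)" "path_length t p4 \<le> 3 * \<bar>a - x\<bar>"
    using horizontal_path[of t b 3 x a] le by auto
  have path: "lattice_path (0, 0) (p1 @ p2 @ p3 @ p4) (a, b)"
    using p1(1) p2(1) p3(1) p4(1) lattice_path_append by blast
  have "real_of_int \<bar>x - 0\<bar> \<le> \<bar>a\<bar> + N" "real_of_int \<bar>b - y\<bar> \<le> \<bar>b\<bar> + N"
    using x(1,2) y(1,2) by linarith+
  then have "c * real_of_int \<bar>x - 0\<bar> \<le> c * (\<bar>a\<bar> + N)" "c * real_of_int \<bar>b - y\<bar> \<le> c * (\<bar>b\<bar> + N)"
    using c(1) by (intro mult_left_mono; simp)+
  moreover have "c * N \<le> 3 * real_of_int N" using c(2) by (intro mult_right_mono) (simp_all add: N_def)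
  moreover have "real_of_int \<bar>y - 0\<bar> \<le> N" "real_of_int \<bar>a - x\<bar> \<le> N"
    using x(1,2) y(1,2) by linarith+
  \<comment> \<open>Four errors of at most \<open>3 * N\<close> each give 12: the short pieces
    \<open>p1\<close> and \<open>p4\<close>, and the overshoots of \<open>p2\<close> and
    \<open>p3\<close>.\<close>
  ultimately have "path_length t (p1 @ p2 @ p3 @ p4) \<le> c * (\<bar>a\<bar> + \<bar>b\<bar>) + 12 * N"
    using p1(2) p2(2) p3(2) p4(2) unfolding path_length_append ring_distribs of_int_add by linarith
  with passage_time_le[of t, OF ge path] show ?thesis
    unfolding c_def N_def by simp
qed

section \<open>The limiting shape\<close>

abbreviation l1_ball :: "(real \<times> real) set" where
  "l1_ball \<equiv> {x. \<bar>fst x\<bar> + \<bar>snd x\<bar> \<le> 1}"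

lemma compact_l1_ball: "compact l1_ball"
proof -
  have "bounded l1_ball"
  proof (rule boundedI)
    fix x :: "real \<times> real"
    assume "x \<in> l1_ball"
    then show "norm x \<le> 1"
      using norm_Pair_le[of "fst x" "snd x"] by simp
  qed
  moreover have "closed l1_ball"
    by (intro closed_Collect_le continuous_intros)
  ultimately show ?thesis by (simp add: compact_eq_bounded_closed)
qed

lemma convex_l1_ball: "convex l1_ball"
proof (rule convexI)
  fix x y :: "real \<times> real" and u v :: real
  assume x: "x \<in> l1_ball" and y: "y \<in> l1_ball" and uv: "0 \<le> u" "0 \<le> v" "u + v = 1"
  have "\<bar>u * fst x + v * fst y\<bar> \<le> u * \<bar>fst x\<bar> + v * \<bar>fst y\<bar>"
       "\<bar>u * snd x + v * snd y\<bar> \<le> u * \<bar>snd x\<bar> + v * \<bar>snd y\<bar>"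
    using uv by (metis abs_mult abs_of_nonneg abs_triangle_ineq)+
  moreover have "u * (\<bar>fst x\<bar> + \<bar>snd x\<bar>) \<le> u * 1" "v * (\<bar>fst y\<bar> + \<bar>snd y\<bar>) \<le> v * 1"
    using x y uv by (intro mult_left_mono; simp)+
  ultimately show "u *\<^sub>R x + v *\<^sub>R y \<in> l1_ball"
    using uv by (simp add: algebra_simps)
qed

text \<open>By the l1 lower bound the floor of a wet point has l1 norm below \<open>R\<close>.
  Undoing the floor adds at most 2, which \<open>\<epsilon> * R\<close> absorbs for large
  \<open>R\<close>.\<close>

lemma scaled_wet_region_subset:
  assumes ge: "\<And>e. 1 \<le> t e" and "0 < \<epsilon>"
  shows "\<forall>\<^sub>F R in at_top.
    (\<lambda>x. (1 / R) *\<^sub>R x) ` wet_region t R \<subseteq> (\<lambda>x. (1 + \<epsilon>) *\<^sub>R x) ` l1_ball"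
proof -
  have "\<forall>\<^sub>F R in at_top. max 1 (2 / \<epsilon>) \<le> R" by (rule eventually_ge_at_top)
  then show ?thesis
  proof eventually_elim
    case (elim R)
    then have R: "0 < R" "2 \<le> \<epsilon> * R" using \<open>0 < \<epsilon>\<close> by (auto simp: field_simps)
    show ?case
    proof (rule image_subsetI)
      fix x
      assume "x \<in> wet_region t R"
      then have "real_of_int (\<bar>\<lfloor>fst x\<rfloor>\<bar> + \<bar>\<lfloor>snd x\<rfloor>\<bar>) < R"
        using passage_time_ge[of t "floor_point x" "floor_point 0", OF ge]
        by (simp add: wet_region_def passage_time_plane_def floor_point_def)
      then have "\<bar>fst x\<bar> + \<bar>snd x\<bar> \<le> R + 2" by linarith
      also have "\<dots> \<le> (1 + \<epsilon>) * R" using R(2) by (simp add: algebra_simps)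
      finally have "(1 / ((1 + \<epsilon>) * R)) *\<^sub>R x \<in> l1_ball"
        using R(1) \<open>0 < \<epsilon>\<close> by (simp add: abs_mult add_divide_distrib[symmetric])
      moreover have "(1 / R) *\<^sub>R x = (1 + \<epsilon>) *\<^sub>R ((1 / ((1 + \<epsilon>) * R)) *\<^sub>R x)"
        using \<open>0 < \<epsilon>\<close> by simp
      ultimately show "(1 / R) *\<^sub>R x \<in> (\<lambda>x. (1 + \<epsilon>) *\<^sub>R x) ` l1_ball" by blast
    qed
  qed
qed

text \<open>With \<open>k\<close> fixed, points of l1 norm at most
  \<open>(1 - \<epsilon>) * R\<close> are reached in time \<open>c * (1 - \<epsilon>) * R\<close>
  plus a constant, and \<open>c * (1 - \<epsilon>) < 1\<close> leaves linear room for that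
  constant.\<close>

lemma subset_scaled_wet_region:
  assumes reg: "regular_times \<alpha> t" and \<alpha>: "0 < \<alpha>" "\<alpha> < 1" and \<epsilon>: "0 < \<epsilon>" "\<epsilon> < 1"
  shows "\<forall>\<^sub>F R in at_top.
    (\<lambda>x. (1 - \<epsilon>) *\<^sub>R x) ` l1_ball \<subseteq> (\<lambda>x. (1 / R) *\<^sub>R x) ` wet_region t R"
proof -
  \<comment> \<open>The level is chosen so that \<open>c < 1 + \<epsilon>\<close>, whence
    \<open>c * (1 - \<epsilon>) < 1 - \<epsilon>^2 < 1\<close>.\<close>
  obtain k where k: "\<alpha> ^ k < \<epsilon> / 2"
    using real_arch_pow_inv[of "\<epsilon> / 2" \<alpha>] \<epsilon> \<alpha> by auto
  define c where "c = 1 + 2 * \<alpha> ^ k"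
  \<comment> \<open>The term \<open>2 * c\<close> pays for the two floors, the other one for the
    detour.\<close>
  define A where "A = 2 * c + 12 * 5 ^ Suc k"
  have "0 < c" using \<alpha> by (simp add: c_def add_pos_pos)
  have "c * (1 - \<epsilon>) < (1 + \<epsilon>) * (1 - \<epsilon>)"
    using k \<epsilon> by (intro mult_strict_right_mono) (auto simp: c_def)
  also have "\<dots> < 1" using \<epsilon> by (simp add: algebra_simps)
  finally have pos: "0 < 1 - c * (1 - \<epsilon>)" by simp
  have "\<forall>\<^sub>F R in at_top. max 0 (A / (1 - c * (1 - \<epsilon>))) < R" by (rule eventually_gt_at_top)
  then show ?thesis
  proof eventually_elim
    case (elim R)
    then have "0 < R" and "A / (1 - c * (1 - \<epsilon>)) < R" by auto
    with pos have A: "A < R - c * (1 - \<epsilon>) * R" by (simp add: field_simps)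
    show ?case
    proof (rule image_subsetI)
      fix x :: "real \<times> real"
      assume x: "x \<in> l1_ball"
      define z where "z = (R * (1 - \<epsilon>)) *\<^sub>R x"
      have "R * (1 - \<epsilon>) * (\<bar>fst x\<bar> + \<bar>snd x\<bar>) \<le> R * (1 - \<epsilon>) * 1"
        using x \<open>0 < R\<close> \<epsilon> by (intro mult_left_mono) auto
      then have "\<bar>fst z\<bar> + \<bar>snd z\<bar> \<le> R * (1 - \<epsilon>)"
        using \<open>0 < R\<close> \<epsilon> by (simp add: z_def abs_mult distrib_left)
      then have "real_of_int (\<bar>\<lfloor>fst z\<rfloor>\<bar> + \<bar>\<lfloor>snd z\<rfloor>\<bar>) \<le> R * (1 - \<epsilon>) + 2" by linarith
      then have "c * real_of_int (\<bar>\<lfloor>fst z\<rfloor>\<bar> + \<bar>\<lfloor>snd z\<rfloor>\<bar>) \<le> c * (R * (1 - \<epsilon>) + 2)"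
        using \<open>0 < c\<close> by (intro mult_left_mono) auto
      then have "passage_time_plane t 0 z \<le> c * (R * (1 - \<epsilon>) + 2) + 12 * 5 ^ Suc k"
        using passage_time_le_regular[OF reg \<alpha>, of "\<lfloor>fst z\<rfloor>" "\<lfloor>snd z\<rfloor>" k]
        unfolding c_def passage_time_plane_def floor_point_def by simp
      also have "\<dots> < R" using A unfolding A_def by (simp add: algebra_simps)
      finally have "z \<in> wet_region t R" by (simp add: wet_region_def)
      moreover have "(1 - \<epsilon>) *\<^sub>R x = (1 / R) *\<^sub>R z" using \<open>0 < R\<close> by (simp add: z_def)
      ultimately show "(1 - \<epsilon>) *\<^sub>R x \<in> (\<lambda>x. (1 / R) *\<^sub>R x) ` wet_region t R" by blast
    qed
  qed
qed

theorem corollary2: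
  fixes \<alpha> :: real
  assumes "0 < \<alpha>" and "\<alpha> < 0.2"
  shows "is_limiting_shape (passage_law \<alpha>) {x. \<bar>fst x\<bar> + \<bar>snd x\<bar> \<le> 1}"
  unfolding is_limiting_shape_def
proof (intro conjI allI impI compact_l1_ball convex_l1_ball)
  fix \<epsilon> :: real
  assume \<epsilon>: "0 < \<epsilon> \<and> \<epsilon> < 1"
  have \<alpha>: "0 < \<alpha>" "\<alpha> < 1" using assms by auto
  show "AE t in passage_law \<alpha>. \<forall>\<^sub>F R in at_top.
      (\<lambda>x. (1 - \<epsilon>) *\<^sub>R x) ` l1_ball \<subseteq> (\<lambda>x. (1 / R) *\<^sub>R x) ` wet_region t R \<and>
      (\<lambda>x. (1 / R) *\<^sub>R x) ` wet_region t R \<subseteq> (\<lambda>x. (1 + \<epsilon>) *\<^sub>R x) ` l1_ball"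
    \<comment> \<open>Regularity depends on neither \<open>\<epsilon>\<close> nor \<open>R\<close>.
      From here on the argument is deterministic for each regular \<open>t\<close>.\<close>
    using AE_regular[OF \<alpha>]
  proof eventually_elim
    case (elim t)
    then have "1 \<le> t e" for e unfolding regular_times_def by blast
    then show ?case
      using subset_scaled_wet_region[OF elim \<alpha>, of \<epsilon>] scaled_wet_region_subset[of t \<epsilon>] \<epsilon>
      by (simp add: eventually_conj)
  qed
qed

end
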